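(* Let $G$ be a group and $\epsilon>0$. Suppose $n,m$ and $s_1\leq s_2$ are integers such that $\log n \leq s_2 \leq m \leq s_1^2\log n$. Let $F_1,F_2\subset G$ with $|F_1|=|F_2|=n$ and let $F=F_1F_2$. Then there exists a family $\mathcal{A}\subset 2^{F_1}\times 2^{F_2}\times 2^{F}$ of triples $(A_1,A_2,B)$ of size \[|\mathcal{A}| \leq \exp\left(2^{20}\epsilon^{-2}\sqrt{m}(\log n)^{3/2} \right)\] such that the following hold: (1) For all $X_1\subset F_1$, $X_2\subset F_2$ with $|X_i|=s_i$ and $|X_1X_2|\leq m$, there exists a triple $(A_1,A_2,B)\in\mathcal{A}$ with $X_1\subset A_1$, $X_2\subset A_2$ and $B\subset X_1X_2$. (2) For every $(A_1,A_2,B)\in\mathcal{A}$, either $\max\{|A_1|,|A_2|\}\leq m/\log n$, or there are at most $\epsilon^2 |A_1||A_2|$ pairs $(a_1,a_2)\in A_1\times A_2$ such that $a_1a_2\notin B$.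
   Context: For subsets $X,Y$ of a group, $XY=\{xy: x\in X, y\in Y\}$ is the product set. $2^{S}$ denotes the power set of $S$. *)

theory Defs
  imports Complex_Main "HOL-Algebra.Coset"
begin

end

theory Submission
  imports Defs
begin

text \<open>
  This is a graph-container argument. Put \<open>L = log n\<close>, \<open>h = \<epsilon>^2 / 2\<close> and \<open>k = \<lceil>sqrt (m / L)\<rceil>\<close>.
  Start from \<open>(F\<^sub>1, F\<^sub>2, {})\<close> and refine a triple \<open>(A\<^sub>1, A\<^sub>2, B)\<close> with \<open>X\<^sub>i \<subseteq> A\<^sub>i\<close>, \<open>B \<subseteq> X\<^sub>1 X\<^sub>2\<close> as long as it
  violates (2). Say \<open>A\<^sub>2\<close> is the larger side, and let \<open>D\<close> be the set of \<open>a \<in> A\<^sub>1\<close> for which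
  \<open>a y \<notin> B\<close> for at least \<open>h |A\<^sub>2|\<close> elements \<open>y\<close> of \<open>A\<^sub>2\<close>; then \<open>|D| \<ge> h |A\<^sub>1|\<close>.

  If \<open>X\<^sub>1\<close> has fewer than \<open>k\<close> elements in \<open>D\<close>, naming them lets us discard the rest of \<open>D\<close>.
  Otherwise name a \<open>k\<close>-set \<open>T \<subseteq> X\<^sub>1 \<inter> D\<close> and a maximal \<open>S \<subseteq> X\<^sub>2\<close> each of whose elements contributes on average
  \<open>h k / 2\<close> new products to \<open>B \<union> T S\<close>. By maximality every \<open>y \<in> X\<^sub>2\<close> has at most \<open>h k / 2\<close> products
  \<open>t y\<close> outside \<open>B' = B \<union> T S\<close>, so \<open>A\<^sub>2\<close> may be cut down to the \<open>y\<close> with this property; if few elements are cut,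
  double counting shows that \<open>B\<close> has gained at least \<open>h |A\<^sub>2| / 4 > h m / (4 L)\<close> elements. Hence there are
  \<open>O(L / h)\<close> rounds, each naming \<open>k\<close> elements, while since \<open>|B| \<le> m\<close> the sets \<open>S\<close> have
  \<open>O(m / (h k))\<close> elements altogether. If \<open>|A\<^sub>1| \<le> 2 k / h\<close>, one finishes in a single step by
  naming all of \<open>X\<^sub>1\<close>, and here \<open>|X\<^sub>1| \<ge> k\<close> is used.
\<close>

section \<open>Elementary estimates and weighted counting of subsets\<close>

lemma half_le_ln2: "1 / 2 \<le> ln (2::real)"
proof -
  have "exp (1 / 2 :: real) ^ 2 = exp 1"
    by (simp flip: exp_of_nat_mult)
  also have "\<dots> \<le> 2 ^ 2"
    using exp_le by simp
  finally have "exp (1 / 2 :: real) \<le> 2"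
    by (rule power2_le_imp_le) simp
  then show ?thesis
    by (subst ln_ge_iff) auto
qed

lemma ln_le_ln_minus:
  fixes x y c :: real
  assumes "0 < x" "0 < y" "x \<le> (1 - c) * y"
  shows "ln x \<le> ln y - c"
proof -
  have "0 < (1 - c) * y"
    using assms by linarith
  then have "0 < 1 - c"
    using assms(2) by (simp add: zero_less_mult_iff)
  then have "ln x \<le> ln (1 - c) + ln y"
    using assms by (simp flip: ln_mult_pos)
  moreover have "ln (1 - c) \<le> (1 - c) - 1"
    using \<open>0 < 1 - c\<close> by (rule ln_le_minus_one)
  ultimately show ?thesis
    by linarith
qed

text \<open>The sum factorises as \<open>(1 + exp (- L)) ^ card F\<close>, and
  \<open>1 + x <= exp x\<close>. Consequence for the container count: a round whose potential drops
  by \<open>L\<close> per named element can afford every choice of the named set, up to a factor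
  \<open>exp 1\<close>.\<close>

lemma sum_Pow_exp_card_le:
  assumes "finite F" "real (card F) \<le> exp L"
  shows "(\<Sum>P\<in>Pow F. exp (- L * real (card P))) \<le> exp 1"
proof -
  have "(\<Sum>P\<in>Pow F. exp (- L * real (card P))) = (\<Prod>x\<in>F. exp (- L) + 1)"
    using assms(1) by (subst prod_add) (auto simp: exp_of_nat_mult[symmetric] mult.commute intro!: sum.cong)
  also have "\<dots> = (1 + exp (- L)) ^ card F"
    by (simp add: add.commute)
  also have "\<dots> \<le> exp (exp (- L)) ^ card F"
    by (intro power_mono) (auto simp: add_nonneg_nonneg)
  also have "\<dots> = exp (real (card F) * exp (- L))"
    by (simp add: exp_of_nat_mult)
  also have "\<dots> \<le> exp 1"
    using assms(2) by (simp add: exp_minus field_simps)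
  finally show ?thesis .
qed

text \<open>Exponential Markov bound: every set counted has weight at least
  \<open>exp (- L * q)\<close> in the sum of the previous lemma.\<close>

lemma card_small_subsets_le:
  assumes "finite F" "real (card F) \<le> exp L" "0 \<le> L"
  shows "real (card {P. P \<subseteq> F \<and> real (card P) \<le> q}) \<le> exp (1 + L * q)"
proof -
  let ?I = "{P. P \<subseteq> F \<and> real (card P) \<le> q}"
  have "real (card ?I) * exp (- L * q) = (\<Sum>P\<in>?I. exp (- L * q))"
    by simp
  also have "\<dots> \<le> (\<Sum>P\<in>?I. exp (- L * real (card P)))"
    using assms(3) by (intro sum_mono) (auto intro: mult_left_mono)
  also have "\<dots> \<le> (\<Sum>P\<in>Pow F. exp (- L * real (card P)))"
    using assms(1) by (intro sum_mono2) auto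
  also have "\<dots> \<le> exp 1"
    by (rule sum_Pow_exp_card_le) (use assms in auto)
  finally show ?thesis
    by (simp add: exp_minus exp_add field_simps)
qed

section \<open>Triples, container families and the potential\<close>

locale container_setup =
  fixes f :: "'a \<Rightarrow> 'b \<Rightarrow> 'c"
    and F1 :: "'a set" and F2 :: "'b set"
    and s1 s2 m k :: nat
    and L h :: real
  assumes inj1: "\<And>y. y \<in> F2 \<Longrightarrow> inj_on (\<lambda>x. f x y) F1"
    and inj2: "\<And>x. x \<in> F1 \<Longrightarrow> inj_on (f x) F2"
    and fin1: "finite F1" and fin2: "finite F2"
    and card1: "real (card F1) \<le> exp L" and card2: "real (card F2) \<le> exp L"
    and L_ge: "1 / 2 \<le> L"
    and h_pos: "0 < h"
    and k_pos: "0 < k" and k_le1: "k \<le> s1" and k_le2: "k \<le> s2"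
    and k_upper: "real k ^ 2 * L \<le> 4 * real m"
begin

definition prods :: "'a set \<Rightarrow> 'b set \<Rightarrow> 'c set"
  where "prods X Y = (\<lambda>(x, y). f x y) ` (X \<times> Y)"

definition admissible :: "'a set \<Rightarrow> 'b set \<Rightarrow> 'c set \<Rightarrow> 'a set \<Rightarrow> 'b set \<Rightarrow> bool"
  where "admissible A1 A2 B X1 X2 \<longleftrightarrow>
    X1 \<subseteq> A1 \<and> X2 \<subseteq> A2 \<and> card X1 = s1 \<and> card X2 = s2 \<and>
    B \<subseteq> prods X1 X2 \<and> card (prods X1 X2) \<le> m"

definition bad_pairs :: "'a set \<Rightarrow> 'b set \<Rightarrow> 'c set \<Rightarrow> ('a \<times> 'b) set"
  where "bad_pairs A1 A2 B = {(x, y) \<in> A1 \<times> A2. f x y \<notin> B}"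

text \<open>Since \<open>h\<close> is half of eps^2, \<open>2 * h\<close> is the density allowed in
  (2). The spare \<open>h\<close> lets a triple that is not final have many vertices of degree at
  least \<open>h\<close> times the opposite side.\<close>

definition final :: "'a set \<Rightarrow> 'b set \<Rightarrow> 'c set \<Rightarrow> bool"
  where "final A1 A2 B \<longleftrightarrow>
    real (max (card A1) (card A2)) \<le> real m / L \<or>
    real (card (bad_pairs A1 A2 B)) \<le> 2 * h * real (card A1) * real (card A2)"

text \<open>The third component ranges over \<open>UNIV\<close>; the theorem for groups later keeps
  only the triples with \<open>B\<close> inside \<open>F\<close>. Finiteness is demanded because
  \<open>card\<close> of an infinite family is 0, which would make a bound on it void.\<close>

definition container_family :: "'a set \<Rightarrow> 'b set \<Rightarrow> 'c set \<Rightarrow> ('a set \<times> 'b set \<times> 'c set) set \<Rightarrow> bool"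
  where "container_family A1 A2 B \<A> \<longleftrightarrow> finite \<A> \<and> \<A> \<subseteq> Pow A1 \<times> Pow A2 \<times> UNIV \<and>
    (\<forall>X1 X2. admissible A1 A2 B X1 X2 \<longrightarrow>
      (\<exists>(C1, C2, D) \<in> \<A>. X1 \<subseteq> C1 \<and> X2 \<subseteq> C2 \<and> D \<subseteq> prods X1 X2)) \<and>
    (\<forall>(C1, C2, D) \<in> \<A>. final C1 C2 D)"

definition containable :: "'a set \<Rightarrow> 'b set \<Rightarrow> 'c set \<Rightarrow> real \<Rightarrow> bool"
  where "containable A1 A2 B c \<longleftrightarrow> (\<exists>\<A>. container_family A1 A2 B \<A> \<and> real (card \<A>) \<le> c)"

text \<open>Every round shrinks \<open>card A1\<close> or \<open>card A2\<close> by the factor \<open>1 - h / 4\<close> or enlarges \<open>B\<close> by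
  \<open>h * m / (4 * L)\<close>; the coefficients are chosen so that the resulting drop pays for the number of
  possible fingerprints of that round.\<close>

definition potential :: "'a set \<Rightarrow> 'b set \<Rightarrow> 'c set \<Rightarrow> real"
  where "potential A1 A2 B =
    20 * real k * L / h * (ln (real (card A1)) + ln (real (card A2))) +
    160 * L / (h * real k) * (real m - real (card B)) +
    (2 * real k / h + 1 + L * real m / (2 * h * real k))"

section \<open>Symmetry, gluing of families and saturating sets\<close>

lemma L_pos: "0 < L"
  using L_ge by linarith

lemma finite_prods: "finite X \<Longrightarrow> finite Y \<Longrightarrow> finite (prods X Y)"
  by (simp add: prods_def)

lemma prods_mono: "X \<subseteq> X' \<Longrightarrow> Y \<subseteq> Y' \<Longrightarrow> prods X Y \<subseteq> prods X' Y'"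
  by (auto simp: prods_def)

text \<open>The locale assumes injectivity of \<open>f\<close> in each variable instead of a group
  law, and \<open>k\<close> below both \<open>s1\<close> and \<open>s2\<close>, so that the setting
  is symmetric and only one orientation of a round has to be analysed.\<close>

lemma swapped: "container_setup (\<lambda>y x. f x y) F2 F1 s2 s1 m k L h"
  using inj1 inj2 fin1 fin2 card1 card2 L_ge h_pos k_pos k_le1 k_le2 k_upper
  by unfold_locales (auto simp: inj_on_def)

lemma containableI:
  assumes "\<A> \<subseteq> Pow A1 \<times> Pow A2 \<times> UNIV" "finite \<A>" "real (card \<A>) \<le> c"
    and "\<And>X1 X2. admissible A1 A2 B X1 X2 \<Longrightarrow>
        \<exists>(C1, C2, D) \<in> \<A>. X1 \<subseteq> C1 \<and> X2 \<subseteq> C2 \<and> D \<subseteq> prods X1 X2"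
    and "\<And>C1 C2 D. (C1, C2, D) \<in> \<A> \<Longrightarrow> final C1 C2 D"
  shows "containable A1 A2 B c"
proof -
  have "\<forall>(C1, C2, D) \<in> \<A>. final C1 C2 D"
    using assms(5) by (auto split: prod.split)
  then have "container_family A1 A2 B \<A>"
    unfolding container_family_def using assms(1,2,4) by (intro conjI allI impI)
  then show ?thesis
    using assms(3) by (auto simp: containable_def)
qed

lemma container_family_final:
  assumes "container_family A1 A2 B \<A>" "(C1, C2, D) \<in> \<A>"
  shows "final C1 C2 D"
proof -
  have "\<forall>(C1, C2, D) \<in> \<A>. final C1 C2 D"
    using assms(1) unfolding container_family_def by (elim conjE)
  then show ?thesis
    using assms(2) by (auto dest: bspec)
qed

text \<open>Branching: an index \<open>i\<close> is a possible fingerprint. Each admissible pair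
  survives in at least one branch, so the union of the branch families serves all pairs and the
  costs add up.\<close>

lemma containable_UN:
  assumes "finite I"
    and sub: "\<And>i. i \<in> I \<Longrightarrow> a1 i \<subseteq> A1 \<and> a2 i \<subseteq> A2"
    and cont: "\<And>i. i \<in> I \<Longrightarrow> containable (a1 i) (a2 i) (b i) (c i)"
    and cover: "\<And>X1 X2. admissible A1 A2 B X1 X2 \<Longrightarrow>
      \<exists>i\<in>I. admissible (a1 i) (a2 i) (b i) X1 X2"
    and total: "sum c I \<le> t"
  shows "containable A1 A2 B t"
proof -
  obtain \<A> where fam: "\<And>i. i \<in> I \<Longrightarrow> container_family (a1 i) (a2 i) (b i) (\<A> i)"
    and card: "\<And>i. i \<in> I \<Longrightarrow> real (card (\<A> i)) \<le> c i"
    using cont unfolding containable_def by metis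
  show ?thesis
  proof (rule containableI)
    show "(\<Union>i\<in>I. \<A> i) \<subseteq> Pow A1 \<times> Pow A2 \<times> UNIV"
      using fam sub unfolding container_family_def by fast
    show "finite (\<Union>i\<in>I. \<A> i)"
      using fam assms(1) unfolding container_family_def by blast
    have "real (card (\<Union>i\<in>I. \<A> i)) \<le> real (\<Sum>i\<in>I. card (\<A> i))"
      using card_UN_le[OF assms(1)] of_nat_le_iff by blast
    also have "\<dots> \<le> sum c I"
      using card by (simp add: sum_mono)
    finally show "real (card (\<Union>i\<in>I. \<A> i)) \<le> t"
      using total by linarith
    fix X1 X2 assume "admissible A1 A2 B X1 X2"
    then obtain i where "i \<in> I" "admissible (a1 i) (a2 i) (b i) X1 X2"
      using cover by blast
    then have "\<exists>(C1, C2, D) \<in> \<A> i. X1 \<subseteq> C1 \<and> X2 \<subseteq> C2 \<and> D \<subseteq> prods X1 X2"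
      using fam[of i] unfolding container_family_def by metis
    then show "\<exists>(C1, C2, D) \<in> (\<Union>i\<in>I. \<A> i). X1 \<subseteq> C1 \<and> X2 \<subseteq> C2 \<and> D \<subseteq> prods X1 X2"
      using \<open>i \<in> I\<close> by blast
  next
    fix C1 C2 D assume "(C1, C2, D) \<in> (\<Union>i\<in>I. \<A> i)"
    then obtain i where "i \<in> I" "(C1, C2, D) \<in> \<A> i"
      by blast
    then show "final C1 C2 D"
      using container_family_final[OF fam] by blast
  qed
qed

text \<open>Take \<open>S\<close> of largest size with the growth property, which \<open>{}\<close>
  has. A \<open>y\<close> with more than \<open>d\<close> new products could be inserted into
  \<open>S\<close>: by injectivity of \<open>f\<close> in its first argument these products are
  distinct, so the growth property would persist.\<close>

lemma exists_saturating_set: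
  assumes "X \<subseteq> F1" "Y \<subseteq> F2" "finite B" "0 \<le> d"
  obtains S where "S \<subseteq> Y" "real (card B) + real (card S) * d \<le> real (card (B \<union> prods X S))"
    "\<And>y. y \<in> Y \<Longrightarrow> real (card {x \<in> X. f x y \<notin> B \<union> prods X S}) \<le> d"
proof -
  have finX: "finite X" and finY: "finite Y"
    using assms fin1 fin2 finite_subset by blast+
  define P where "P S \<longleftrightarrow> S \<subseteq> Y \<and>
    real (card B) + real (card S) * d \<le> real (card (B \<union> prods X S))" for S
  have "P {}"
    by (simp add: P_def prods_def)
  moreover have "\<forall>S. P S \<longrightarrow> card S \<le> card Y"
    using finY by (auto simp: P_def intro: card_mono)
  ultimately obtain S where S: "P S" and max: "\<And>S'. P S' \<Longrightarrow> card S' \<le> card S"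
    using ex_has_greatest_nat[of P "{}" card "Suc (card Y)"] by (auto simp: less_Suc_eq_le)
  have SY: "S \<subseteq> Y" and finS: "finite S"
    using S finY finite_subset by (auto simp: P_def)
  show thesis
  proof
    show "S \<subseteq> Y" "real (card B) + real (card S) * d \<le> real (card (B \<union> prods X S))"
      using S by (auto simp: P_def)
    fix y assume y: "y \<in> Y"
    show "real (card {x \<in> X. f x y \<notin> B \<union> prods X S}) \<le> d"
    proof (rule ccontr)
      assume neg: "\<not> ?thesis"
      let ?N = "{x \<in> X. f x y \<notin> B \<union> prods X S}"
      have "?N \<noteq> {}"
        using neg assms(4) by (metis card.empty of_nat_0)
      then have "y \<notin> S"
        by (auto simp: prods_def)
      have eq: "B \<union> prods X (insert y S) = (B \<union> prods X S) \<union> (\<lambda>x. f x y) ` ?N"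
        by (auto simp: prods_def)
      have "card ((\<lambda>x. f x y) ` ?N) = card ?N"
        using inj1[of y] y assms by (intro card_image) (auto simp: inj_on_def)
      then have "card (B \<union> prods X (insert y S)) = card (B \<union> prods X S) + card ?N"
        unfolding eq using finX finS assms(3)
        by (subst card_Un_disjoint) (auto simp: finite_prods)
      then have "P (insert y S)"
        using S y neg \<open>y \<notin> S\<close> finS by (auto simp: P_def algebra_simps)
      then show False
        using max[of "insert y S"] \<open>y \<notin> S\<close> finS by simp
    qed
  qed
qed

section \<open>Double counting and the case of a small side\<close>

lemma card_bad_pairs_by_right:
  assumes "finite X" "finite Y"
  shows "card (bad_pairs X Y B) = (\<Sum>y\<in>Y. card {x \<in> X. f x y \<notin> B})"
proof -
  have "bad_pairs X Y B = prod.swap ` (SIGMA y:Y. {x \<in> X. f x y \<notin> B})"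
    by (auto simp: bad_pairs_def)
  then show ?thesis
    using assms by (simp add: card_image)
qed

lemma card_bad_pairs_by_left:
  assumes "finite X" "finite Y"
  shows "card (bad_pairs X Y B) = (\<Sum>x\<in>X. card {y \<in> Y. f x y \<notin> B})"
proof -
  have "bad_pairs X Y B = (SIGMA x:X. {y \<in> Y. f x y \<notin> B})"
    by (auto simp: bad_pairs_def)
  then show ?thesis
    using assms by simp
qed

text \<open>Naming all of \<open>X1\<close> costs at most 2^|A1| choices. With a saturating
  \<open>S\<close> at threshold \<open>2 * h * s1\<close> this fixes a final triple: each
  \<open>y\<close> in \<open>C X S\<close> has at most \<open>2 * h * card X\<close> products
  outside \<open>D X S\<close>; sum over \<open>y\<close>. Each element of \<open>S\<close> accounts
  for at least \<open>2 * h * k\<close> of at most \<open>m\<close> products, hence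
  \<open>card S <= q\<close>.\<close>

lemma containable_small:
  assumes A: "A1 \<subseteq> F1" "A2 \<subseteq> F2" "finite B"
    and small: "real (card A1) \<le> 2 * real k / h"
  shows "containable A1 A2 B (exp (2 * real k / h + 1 + L * real m / (2 * h * real k)))"
proof -
  have finA: "finite A1" "finite A2"
    using A fin1 fin2 finite_subset by blast+
  define q where "q = real m / (2 * h * real k)"
  define I where "I = {X. X \<subseteq> A1 \<and> card X = s1} \<times> {S. S \<subseteq> F2 \<and> real (card S) \<le> q}"
  define D where "D X S = B \<union> prods X S" for X S
  define C where "C X S = {y \<in> A2. real (card {x \<in> X. f x y \<notin> D X S}) \<le> 2 * h * real s1}" for X S
  have finI: "finite I"
    unfolding I_def using finA fin2 by auto
  show ?thesis
  proof (rule containableI)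
    let ?\<A> = "(\<lambda>(X, S). (X, C X S, D X S)) ` I"
    show "?\<A> \<subseteq> Pow A1 \<times> Pow A2 \<times> UNIV"
      by (auto simp: I_def C_def)
    show "finite ?\<A>"
      using finI by simp
    have "real (card ?\<A>) \<le> real (card I)"
      using finI card_image_le of_nat_le_iff by blast
    also have "\<dots> = real (card {X. X \<subseteq> A1 \<and> card X = s1}) * real (card {S. S \<subseteq> F2 \<and> real (card S) \<le> q})"
      by (simp add: I_def card_cartesian_product)
    also have "\<dots> \<le> exp (2 * real k / h) * exp (1 + L * q)"
    proof (intro mult_mono)
      have "real (card {X. X \<subseteq> A1 \<and> card X = s1}) \<le> real (card (Pow A1))"
        using finA by (intro of_nat_mono card_mono) auto
      also have "\<dots> = 2 ^ card A1"
        using finA by (simp add: card_Pow)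
      also have "\<dots> \<le> exp 1 ^ card A1"
        using exp_ge_add_one_self[of 1] by (intro power_mono) auto
      also have "\<dots> = exp (real (card A1))"
        by (simp flip: exp_of_nat_mult)
      also have "\<dots> \<le> exp (2 * real k / h)"
        using small by simp
      finally show "real (card {X. X \<subseteq> A1 \<and> card X = s1}) \<le> exp (2 * real k / h)" .
      show "real (card {S. S \<subseteq> F2 \<and> real (card S) \<le> q}) \<le> exp (1 + L * q)"
        using card_small_subsets_le[OF fin2 card2] L_pos by simp
    qed auto
    also have "\<dots> = exp (2 * real k / h + 1 + L * real m / (2 * h * real k))"
      by (simp add: q_def flip: exp_add)
    finally show "real (card ?\<A>) \<le> exp (2 * real k / h + 1 + L * real m / (2 * h * real k))" .
  next
    fix X1 X2 assume adm: "admissible A1 A2 B X1 X2"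
    then have X: "X1 \<subseteq> F1" "X2 \<subseteq> F2"
      using A by (auto simp: admissible_def)
    then have finX: "finite X1" "finite X2"
      using fin1 fin2 finite_subset by blast+
    obtain S where S: "S \<subseteq> X2"
        "real (card B) + real (card S) * (2 * h * real s1) \<le> real (card (B \<union> prods X1 S))"
        "\<And>y. y \<in> X2 \<Longrightarrow> real (card {x \<in> X1. f x y \<notin> B \<union> prods X1 S}) \<le> 2 * h * real s1"
      by (rule exists_saturating_set[OF X A(3), of "2 * h * real s1"]) (use h_pos in auto)
    have sub: "B \<union> prods X1 S \<subseteq> prods X1 X2"
      using adm S(1) prods_mono[of X1 X1 S X2] by (auto simp: admissible_def)
    then have "card (B \<union> prods X1 S) \<le> m"
      using adm card_mono[OF finite_prods[OF finX] sub] by (simp add: admissible_def)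
    then have *: "real (card S) * (2 * h * real s1) \<le> real m"
      using S(2) by linarith
    have "real (card S) * (2 * h * real k) \<le> real (card S) * (2 * h * real s1)"
      using h_pos k_le1 by (intro mult_left_mono) auto
    with * have "real (card S) * (2 * h * real k) \<le> real m"
      by (rule order_trans[rotated])
    then have "real (card S) \<le> q"
      using h_pos k_pos unfolding q_def by (subst pos_le_divide_eq) auto
    then have "(X1, S) \<in> I"
      using adm S(1) X by (auto simp: I_def admissible_def)
    moreover have "X2 \<subseteq> C X1 S"
      using adm S(3) by (auto simp: C_def D_def admissible_def)
    ultimately show "\<exists>(C1, C2, D') \<in> (\<lambda>(X, S). (X, C X S, D X S)) ` I.
        X1 \<subseteq> C1 \<and> X2 \<subseteq> C2 \<and> D' \<subseteq> prods X1 X2"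
      using sub by (intro bexI[of _ "(X1, C X1 S, D X1 S)"]) (auto simp: D_def)
  next
    fix C1 C2 D' assume "(C1, C2, D') \<in> (\<lambda>(X, S). (X, C X S, D X S)) ` I"
    then obtain X S where XS: "(X, S) \<in> I" and eq: "C1 = X" "C2 = C X S" "D' = D X S"
      by auto
    have fin: "finite X" "finite (C X S)"
      using XS finA finite_subset by (auto simp: I_def C_def)
    have "real (card (bad_pairs X (C X S) (D X S))) =
        (\<Sum>y\<in>C X S. real (card {x \<in> X. f x y \<notin> D X S}))"
      by (simp add: card_bad_pairs_by_right[OF fin])
    also have "\<dots> \<le> (\<Sum>y\<in>C X S. 2 * h * real s1)"
      by (intro sum_mono) (auto simp: C_def)
    also have "\<dots> = 2 * h * real (card X) * real (card (C X S))"
      using XS by (simp add: I_def)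
    finally show "final C1 C2 D'"
      by (simp add: final_def eq)
  qed
qed

section \<open>One round of refinement and its mirror image\<close>

lemma round_cost_le: "2 + L * real k \<le> 5 * real k * L"
proof -
  \<comment> \<open>In a round, \<open>L * k\<close> pays for naming \<open>T\<close>, and 2 for the
    two factors \<open>exp 1\<close> from summing over all \<open>T\<close> and all
    \<open>S\<close>.\<close>
  have "1 * (1 / 2) \<le> real k * L"
    using k_pos L_ge by (intro mult_mono) auto
  then show ?thesis
    by (simp add: algebra_simps)
qed

text \<open>The coefficient \<open>20 * k * L / h\<close> is fitted to this case: the logarithm
  falls by at least \<open>h / 4\<close>, so the potential falls by at least
  \<open>5 * k * L\<close>.\<close>

lemma potential_drop_left:
  assumes "0 < card A1" "0 < card A1'" "real (card A1') \<le> (1 - h / 4) * real (card A1)"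
  shows "potential A1' A2 B \<le> potential A1 A2 B - (2 + L * real k)"
proof -
  have "ln (real (card A1')) \<le> ln (real (card A1)) - h / 4"
    using assms by (intro ln_le_ln_minus) auto
  then have "20 * real k * L / h * ln (real (card A1')) \<le>
      20 * real k * L / h * (ln (real (card A1)) - h / 4)"
    using h_pos L_pos by (intro mult_left_mono) auto
  moreover have "20 * real k * L / h * (h / 4) = 5 * real k * L"
    using h_pos by (simp add: field_simps)
  ultimately show ?thesis
    using round_cost_le unfolding potential_def by (simp only: distrib_left right_diff_distrib)
qed

text \<open>The \<open>B\<close>-term is split into halves. One half pays for naming the
  \<open>j\<close> elements of \<open>S\<close>; the round itself is paid by the logarithm if
  \<open>A2\<close> shrinks, and by the other half if \<open>B\<close> grows.\<close>

lemma potential_drop_right: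
  assumes "0 < card A2" "0 < card A2'" "A2' \<subseteq> A2" "finite A2"
    and growth: "real (card B) + real j * (h / 2 * real k) \<le> real (card B')"
    and progress: "real (card A2') \<le> (1 - h / 4) * real (card A2) \<or>
      real (card B) + h / 4 * (real m / L) \<le> real (card B')"
  shows "potential A1 A2' B' \<le> potential A1 A2 B - (2 + L * real k + L * real j)"
proof -
  let ?a = "20 * real k * L / h" and ?b = "160 * L / (h * real k)"
  let ?g = "real (card B') - real (card B)"
  have a: "0 \<le> ?a" and b: "0 \<le> ?b"
    using h_pos L_pos by auto
  have "0 \<le> real j * (h / 2 * real k)"
    using h_pos by simp
  then have g: "0 \<le> ?g"
    using growth by linarith
  have "?b / 2 * (real j * (h / 2 * real k)) \<le> ?b / 2 * ?g"
    using growth b by (intro mult_left_mono) auto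
  moreover have "?b / 2 * (real j * (h / 2 * real k)) = 40 * (L * real j)"
    using h_pos k_pos by (simp add: field_simps)
  moreover have "0 \<le> L * real j"
    using L_pos by simp
  ultimately have g1: "L * real j \<le> ?b / 2 * ?g"
    by linarith
  have ln_mono: "ln (real (card A2')) \<le> ln (real (card A2))"
    using assms by (simp add: card_mono)
  have "5 * real k * L \<le> ?a * (ln (real (card A2)) - ln (real (card A2'))) + ?b / 2 * ?g"
    using progress
  proof
    assume "real (card A2') \<le> (1 - h / 4) * real (card A2)"
    then have "ln (real (card A2')) \<le> ln (real (card A2)) - h / 4"
      using assms by (intro ln_le_ln_minus) auto
    then have "?a * (h / 4) \<le> ?a * (ln (real (card A2)) - ln (real (card A2')))"
      using a by (intro mult_left_mono) auto
    moreover have "?a * (h / 4) = 5 * real k * L"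
      using h_pos by (simp add: field_simps)
    moreover have "0 \<le> ?b / 2 * ?g"
      using b g by (intro mult_nonneg_nonneg) auto
    ultimately show ?thesis
      by linarith
  next
    assume "real (card B) + h / 4 * (real m / L) \<le> real (card B')"
    then have "?b / 2 * (h / 4 * (real m / L)) \<le> ?b / 2 * ?g"
      using b by (intro mult_left_mono) auto
    moreover have "?b / 2 * (h / 4 * (real m / L)) = 20 * real m / real k"
      using h_pos L_pos by (simp add: field_simps)
    \<comment> \<open>This is where \<open>k\<close> must not exceed the order of sqrt (m /
      L).\<close>
    moreover have "5 * real k * L \<le> 20 * real m / real k"
      using k_upper k_pos by (simp add: field_simps power2_eq_square)
    moreover have "0 \<le> ?a * (ln (real (card A2)) - ln (real (card A2')))"
      using a ln_mono by (intro mult_nonneg_nonneg) auto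
    ultimately show ?thesis
      by linarith
  qed
  moreover have "a * (u + v) + b * (w - x) + c - (a * (u + v') + b * (w - y) + c) =
      a * (v - v') + b / 2 * (y - x) + b / 2 * (y - x)" for a b c u v v' w x y :: real
    by (simp add: field_simps)
  then have "potential A1 A2 B - potential A1 A2' B' =
      ?a * (ln (real (card A2)) - ln (real (card A2'))) + ?b / 2 * ?g + ?b / 2 * ?g"
    unfolding potential_def .
  ultimately show ?thesis
    using g1 round_cost_le by linarith
qed

text \<open>The induction hypothesis is an explicit assumption, so that the same step can be applied
  in the swapped instance of the locale.\<close>

lemma containable_step:
  assumes A: "A1 \<subseteq> F1" "A2 \<subseteq> F2" "finite B"
    and large: "2 * real k / h < real (card A1)"
    and big: "real m / L < real (card A2)"
    and bad: "2 * h * real (card A1) * real (card A2) < real (card (bad_pairs A1 A2 B))"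
    and IH: "\<And>A1' A2' B'. A1' \<subseteq> A1 \<Longrightarrow> A2' \<subseteq> A2 \<Longrightarrow> finite B' \<Longrightarrow>
      potential A1' A2' B' \<le> potential A1 A2 B - 1 \<Longrightarrow>
      containable A1' A2' B' (exp (potential A1' A2' B'))"
  shows "containable A1 A2 B (exp (potential A1 A2 B))"
proof -
  have finA: "finite A1" "finite A2"
    using A fin1 fin2 finite_subset by blast+
  have "0 \<le> real m / L"
    using L_pos by simp
  then have A2_pos: "0 < card A2"
    using big by linarith
  have "0 \<le> 2 * real k / h"
    using h_pos by simp
  then have A1_pos: "0 < card A1"
    using large by linarith
  define D where "D = {x \<in> A1. h * real (card A2) \<le> real (card {y \<in> A2. f x y \<notin> B})}"
  have D: "D \<subseteq> A1" "finite D"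
    using finA by (auto simp: D_def)
  have "real (card (bad_pairs A1 A2 B)) = (\<Sum>x\<in>A1. real (card {y \<in> A2. f x y \<notin> B}))"
    by (simp add: card_bad_pairs_by_left[OF finA])
  \<comment> \<open>Elements outside \<open>D\<close> account for at most
    \<open>h * card A1 * card A2\<close> bad pairs, half of what \<open>bad\<close> provides; the
    rest must come from \<open>D\<close>.\<close>
  also have "\<dots> \<le> (\<Sum>x\<in>A1. (if x \<in> D then real (card A2) else 0) + h * real (card A2))"
  proof (rule sum_mono)
    fix x assume x: "x \<in> A1"
    have "real (card {y \<in> A2. f x y \<notin> B}) \<le> real (card A2)"
      using finA by (intro of_nat_mono card_mono) auto
    moreover have "0 \<le> h * real (card A2)"
      using h_pos by simp
    ultimately show "real (card {y \<in> A2. f x y \<notin> B}) \<le>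
        (if x \<in> D then real (card A2) else 0) + h * real (card A2)"
      using x by (auto simp: D_def)
  qed
  also have "\<dots> = real (card D) * real (card A2) + h * real (card A1) * real (card A2)"
    using finA D by (simp add: sum.distrib sum.If_cases Int_absorb1)
  finally have "(h * real (card A1)) * real (card A2) < real (card D) * real (card A2)"
    using bad by linarith
  then have D_large: "h * real (card A1) < real (card D)"
    using A2_pos by simp
  \<comment> \<open>Because \<open>D\<close> has more than \<open>2 * k\<close> elements, keeping
    fewer than \<open>k\<close> of them discards over half of \<open>D\<close>.\<close>
  have "2 * real k < h * real (card A1)"
    using large h_pos by (simp add: field_simps)
  then have D_gt: "2 * real k < real (card D)"
    using D_large by linarith

  txt \<open>A code \<open>(T, S)\<close> records \<open>T = X1 \<inter> D\<close> if this has fewer than \<open>k\<close> elements, and then all other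
    elements of \<open>D\<close> leave \<open>A1\<close>. Otherwise \<open>T\<close> consists of \<open>k\<close> elements of \<open>X1 \<inter> D\<close> and \<open>S \<subseteq> X2\<close> is
    saturating for \<open>T\<close>; then either \<open>A2\<close> shrinks or \<open>prods T S\<close> adds at least \<open>h * m / (4 * L)\<close>
    elements to \<open>B\<close>.\<close>
  define a1 where "a1 = (\<lambda>(T, S::'b set). if card T < k then (A1 - D) \<union> T else A1)"
  define b where "b = (\<lambda>(T, S). if card T < k then B else B \<union> prods T S)"
  define a2 where "a2 = (\<lambda>(T, S). if card T < k then A2
    else {y \<in> A2. real (card {x \<in> T. f x y \<notin> B \<union> prods T S}) \<le> h / 2 * real k})"
  define I where "I = {(T, S). T \<subseteq> D \<and> S \<subseteq> F2 \<and> card T \<le> k \<and> (card T < k \<longrightarrow> S = {}) \<and>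
    (card T = k \<longrightarrow> real (card B) + real (card S) * (h / 2 * real k) \<le> real (card (B \<union> prods T S))) \<and>
    (\<exists>X1 X2. admissible (a1 (T, S)) (a2 (T, S)) (b (T, S)) X1 X2)}"
  have I_sub: "I \<subseteq> Pow F1 \<times> Pow F2"
    using D A by (auto simp: I_def)
  then have finI: "finite I"
    using fin1 fin2 by (meson finite_SigmaI finite_Pow_iff finite_subset)
  have sub: "a1 i \<subseteq> A1 \<and> a2 i \<subseteq> A2" if "i \<in> I" for i
  proof -
    obtain T S where "i = (T, S)" "T \<subseteq> D"
      using \<open>i \<in> I\<close> by (auto simp: I_def)
    then show ?thesis
      using D by (auto simp: a1_def a2_def)
  qed
  have drop: "potential (a1 (T, S)) (a2 (T, S)) (b (T, S)) \<le>
      potential A1 A2 B - (2 + L * real k + L * real (card S))"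
    if i: "(T, S) \<in> I" for T S
  proof -
    have TS: "T \<subseteq> D" "S \<subseteq> F2" "card T \<le> k" "finite T" "finite S" "T \<subseteq> F1"
      using i D A fin2 finite_subset by (auto simp: I_def)
    obtain X1 X2 where adm: "admissible (a1 (T, S)) (a2 (T, S)) (b (T, S)) X1 X2"
      using i by (auto simp: I_def)
    have fin_a: "finite (a1 (T, S))" "finite (a2 (T, S))"
      using sub[OF i] finA finite_subset by blast+
    \<comment> \<open>The admissible pair demanded in \<open>I\<close> keeps both sides nonempty, so
      the potential only takes logarithms of positive numbers.\<close>
    then have "s1 \<le> card (a1 (T, S))" "s2 \<le> card (a2 (T, S))"
      using adm card_mono unfolding admissible_def by metis+
    then have pos: "0 < card (a1 (T, S))" "0 < card (a2 (T, S))"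
      using k_pos k_le1 k_le2 by linarith+
    show ?thesis
    proof (cases "card T < k")
      case True
      then have eq: "a1 (T, S) = (A1 - D) \<union> T" "a2 (T, S) = A2" "b (T, S) = B" "S = {}"
        using i by (auto simp: a1_def a2_def b_def I_def)
      have "card ((A1 - D) \<union> T) \<le> card (A1 - D) + card T"
        by (rule card_Un_le)
      moreover have "card (A1 - D) + card D = card A1"
        using D finA by (metis card_Diff_subset card_mono le_add_diff_inverse2)
      ultimately have "real (card ((A1 - D) \<union> T)) \<le> real (card A1) - real (card D) + real (card T)"
        by linarith
      also have "\<dots> \<le> real (card A1) - h * real (card A1) / 2"
        using True D_large D_gt by linarith
      also have "\<dots> \<le> (1 - h / 4) * real (card A1)"
        using h_pos by (simp add: algebra_simps)
      finally have "potential ((A1 - D) \<union> T) A2 B \<le> potential A1 A2 B - (2 + L * real k)"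
        using pos(1) A1_pos unfolding eq(1) by (intro potential_drop_left)
      then show ?thesis
        unfolding eq(1-3) by (simp add: eq(4))
    next
      case False
      then have cardT: "card T = k"
        using TS by simp
      define B' where "B' = B \<union> prods T S"
      define A2' where "A2' = {y \<in> A2. real (card {x \<in> T. f x y \<notin> B'}) \<le> h / 2 * real k}"
      have eq: "a1 (T, S) = A1" "a2 (T, S) = A2'" "b (T, S) = B'"
        using cardT by (auto simp: a1_def a2_def b_def B'_def A2'_def)
      have growth: "real (card B) + real (card S) * (h / 2 * real k) \<le> real (card B')"
        using i cardT by (auto simp: I_def B'_def)
      have finB': "finite B'"
        using TS A by (simp add: B'_def finite_prods)
      have A2': "A2' \<subseteq> A2"
        by (auto simp: A2'_def)
      have progress: "real (card A2') \<le> (1 - h / 4) * real (card A2) \<or>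
          real (card B) + h / 4 * (real m / L) \<le> real (card B')"
      proof (rule disjCI)
        assume neg: "\<not> real (card B) + h / 4 * (real m / L) \<le> real (card B')"
        let ?deg = "\<lambda>x. real (card {y \<in> A2. f x y \<notin> B})"
        let ?deg' = "\<lambda>x. real (card {y \<in> A2. f x y \<notin> B'})"
        \<comment> \<open>For fixed \<open>x\<close> the products \<open>f x y\<close> are distinct,
          so enlarging \<open>B\<close> lowers the degree of \<open>x\<close> by at most the number
          of new elements.\<close>
        have deg_le: "?deg x \<le> ?deg' x + (real (card B') - real (card B))" if x: "x \<in> T" for x
        proof -
          have "card {y \<in> A2. f x y \<in> B' - B} \<le> card (B' - B)"
            using inj2[of x] x TS A finB'
            by (intro card_inj_on_le[of "f x"]) (auto simp: inj_on_def subset_iff)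
          moreover have "card (B' - B) + card B = card B'"
            using finB' by (metis B'_def A(3) Un_upper1 card_Diff_subset card_mono le_add_diff_inverse2)
          moreover have "card {y \<in> A2. f x y \<notin> B} \<le>
              card {y \<in> A2. f x y \<notin> B'} + card {y \<in> A2. f x y \<in> B' - B}"
          proof -
            have "card {y \<in> A2. f x y \<notin> B} \<le>
                card ({y \<in> A2. f x y \<notin> B'} \<union> {y \<in> A2. f x y \<in> B' - B})"
              using finA by (intro card_mono) auto
            then show ?thesis
              using card_Un_le order_trans by blast
          qed
          ultimately show ?thesis
            by linarith
        qed
        \<comment> \<open>Count the bad pairs between \<open>T\<close> and \<open>A2\<close> twice.
          Each \<open>x\<close> in \<open>T\<close> has degree at least \<open>h * card A2\<close>
          before \<open>B\<close> grows; each \<open>y\<close> in \<open>A2'\<close> has at most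
          \<open>h / 2 * k\<close> bad partners afterwards, each removed \<open>y\<close> at most
          \<open>k\<close>. Little growth of \<open>B\<close> thus forces many removals.\<close>
        have "real k * (h * real (card A2)) = (\<Sum>x\<in>T. h * real (card A2))"
          by (simp add: cardT)
        also have "\<dots> \<le> (\<Sum>x\<in>T. ?deg x)"
          using TS by (intro sum_mono) (auto simp: D_def)
        also have "\<dots> \<le> (\<Sum>x\<in>T. ?deg' x + (real (card B') - real (card B)))"
          using deg_le by (intro sum_mono) auto
        also have "\<dots> = real (card (bad_pairs T A2 B')) + real k * (real (card B') - real (card B))"
          using TS finA by (simp add: sum.distrib card_bad_pairs_by_left cardT)
        also have "real (card (bad_pairs T A2 B')) = (\<Sum>y\<in>A2. real (card {x \<in> T. f x y \<notin> B'}))"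
          using TS finA by (simp add: card_bad_pairs_by_right)
        also have "\<dots> \<le> (\<Sum>y\<in>A2. h / 2 * real k + (if y \<in> A2 - A2' then real k else 0))"
        proof (rule sum_mono)
          fix y assume y: "y \<in> A2"
          have "card {x \<in> T. f x y \<notin> B'} \<le> card T"
            using TS by (intro card_mono) auto
          moreover have "0 \<le> h / 2 * real k"
            using h_pos by simp
          ultimately show "real (card {x \<in> T. f x y \<notin> B'}) \<le>
              h / 2 * real k + (if y \<in> A2 - A2' then real k else 0)"
            using y by (auto simp: A2'_def cardT)
        qed
        also have "\<dots> = real (card A2) * (h / 2 * real k) + real (card (A2 - A2')) * real k"
        proof -
          have "A2 \<inter> {y. y \<notin> A2'} = A2 - A2'"
            by auto
          then show ?thesis
            using finA by (simp add: sum.distrib sum.If_cases)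
        qed
        finally have "real k * (h * real (card A2)) \<le>
            real k * (real (card A2) * (h / 2) + real (card (A2 - A2')) + (real (card B') - real (card B)))"
          by (simp add: algebra_simps)
        then have "h * real (card A2) \<le>
            real (card A2) * (h / 2) + real (card (A2 - A2')) + (real (card B') - real (card B))"
          using k_pos by simp
        moreover have "card (A2 - A2') + card A2' = card A2"
          using finA A2' by (metis card_Diff_subset card_mono finite_subset le_add_diff_inverse2)
        moreover have "h / 4 * (real m / L) \<le> h / 4 * real (card A2)"
          using big h_pos by (intro mult_left_mono) auto
        ultimately show "real (card A2') \<le> (1 - h / 4) * real (card A2)"
          using neg by (simp add: algebra_simps)
      qed
      have "potential A1 A2' B' \<le> potential A1 A2 B - (2 + L * real k + L * real (card S))"
        using pos(2) A2_pos A2' finA growth progress by (intro potential_drop_right) (auto simp: eq)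
      then show ?thesis
        by (simp add: eq)
    qed
  qed
  have cont: "containable (a1 i) (a2 i) (b i) (exp (potential (a1 i) (a2 i) (b i)))" if i: "i \<in> I" for i
  proof (rule IH)
    show "a1 i \<subseteq> A1" "a2 i \<subseteq> A2"
      using sub[OF i] by auto
    obtain T S where TS: "i = (T, S)"
      by force
    have "T \<subseteq> F1" "S \<subseteq> F2"
      using i I_sub TS by auto
    then have "finite T" "finite S"
      using fin1 fin2 finite_subset by blast+
    then show "finite (b i)"
      using A(3) by (auto simp: TS b_def finite_prods)
    have "0 \<le> L * real k" "0 \<le> L * real (card S)"
      using L_pos by auto
    then show "potential (a1 i) (a2 i) (b i) \<le> potential A1 A2 B - 1"
      using drop[of T S] i TS by simp
  qed
  have cover: "\<exists>i\<in>I. admissible (a1 i) (a2 i) (b i) X1 X2" if adm: "admissible A1 A2 B X1 X2" for X1 X2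
  proof -
    have X: "X1 \<subseteq> A1" "X2 \<subseteq> A2" "X1 \<subseteq> F1" "X2 \<subseteq> F2"
      using adm A by (auto simp: admissible_def)
    show ?thesis
    proof (cases "card (X1 \<inter> D) < k")
      case True
      then have "admissible (a1 (X1 \<inter> D, {})) (a2 (X1 \<inter> D, {})) (b (X1 \<inter> D, {})) X1 X2"
        using adm by (auto simp: admissible_def a1_def a2_def b_def)
      moreover from this have "(X1 \<inter> D, {}) \<in> I"
        using True by (auto simp: I_def)
      ultimately show ?thesis
        by blast
    next
      case False
      then obtain T where T: "T \<subseteq> X1 \<inter> D" "card T = k"
        by (meson not_less obtain_subset_with_card_n)
      have "T \<subseteq> F1"
        using T X by blast
      then obtain S where S: "S \<subseteq> X2"
          "real (card B) + real (card S) * (h / 2 * real k) \<le> real (card (B \<union> prods T S))"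
          "\<And>y. y \<in> X2 \<Longrightarrow> real (card {x \<in> T. f x y \<notin> B \<union> prods T S}) \<le> h / 2 * real k"
        by (rule exists_saturating_set[OF _ X(4) A(3), of T "h / 2 * real k"]) (use h_pos in auto)
      have "prods T S \<subseteq> prods X1 X2"
        using T S by (intro prods_mono) auto
      then have "admissible (a1 (T, S)) (a2 (T, S)) (b (T, S)) X1 X2"
        using adm T S(3) by (auto simp: admissible_def a1_def a2_def b_def)
      moreover from this have "(T, S) \<in> I"
        using T S X by (auto simp: I_def)
      ultimately show ?thesis
        by blast
    qed
  qed
  show ?thesis
  proof (rule containable_UN[OF finI sub cont cover])
    \<comment> \<open>The drop leaves the weights \<open>exp (- L * card T)\<close> and
      \<open>exp (- L * card S)\<close>. Extended to all subsets, the sum is a product of two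
      factors at most \<open>exp 1\<close>, which \<open>exp (- 2)\<close> cancels.\<close>
    have "(\<Sum>i\<in>I. exp (potential (a1 i) (a2 i) (b i))) \<le>
        (\<Sum>(T, S)\<in>I. exp (potential A1 A2 B - 2) * (exp (- L * real (card T)) * exp (- L * real (card S))))"
    proof (rule sum_mono, clarify)
      fix T S assume i: "(T, S) \<in> I"
      then have "L * real (card T) \<le> L * real k"
        using L_pos by (auto simp: I_def)
      then show "exp (potential (a1 (T, S)) (a2 (T, S)) (b (T, S))) \<le>
          exp (potential A1 A2 B - 2) * (exp (- L * real (card T)) * exp (- L * real (card S)))"
        using drop[OF i] by (simp flip: exp_add)
    qed
    also have "\<dots> \<le> (\<Sum>(T, S)\<in>Pow F1 \<times> Pow F2.
        exp (potential A1 A2 B - 2) * (exp (- L * real (card T)) * exp (- L * real (card S))))"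
      using I_sub fin1 fin2 by (intro sum_mono2) auto
    also have "\<dots> = exp (potential A1 A2 B - 2) *
        ((\<Sum>T\<in>Pow F1. exp (- L * real (card T))) * (\<Sum>S\<in>Pow F2. exp (- L * real (card S))))"
      unfolding sum_product sum.cartesian_product
      by (subst sum_distrib_left) (simp add: case_prod_unfold)
    also have "\<dots> \<le> exp (potential A1 A2 B - 2) * (exp 1 * exp 1)"
      using sum_Pow_exp_card_le[OF fin1 card1] sum_Pow_exp_card_le[OF fin2 card2]
      by (intro mult_left_mono mult_mono) (auto intro: sum_nonneg)
    also have "\<dots> = exp (potential A1 A2 B)"
      by (simp flip: exp_add)
    finally show "(\<Sum>i\<in>I. exp (potential (a1 i) (a2 i) (b i))) \<le> exp (potential A1 A2 B)" .
  qed
qed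

end

text \<open>Stated outside the locale so that it can be used both ways: to carry the induction
  hypothesis to the swapped instance and to carry the result back.\<close>

lemma containable_swap:
  assumes "container_setup f F1 F2 s1 s2 m k L h"
    and "container_setup.containable f s1 s2 m L h A1 A2 B c"
  shows "container_setup.containable (\<lambda>y x. f x y) s2 s1 m L h A2 A1 B c"
proof -
  interpret container_setup f F1 F2 s1 s2 m k L h
    by (rule assms(1))
  interpret sw: container_setup "\<lambda>y x. f x y" F2 F1 s2 s1 m k L h
    by (rule swapped)
  have prods_swap: "sw.prods Y X = prods X Y" for X Y
    by (auto simp: prods_def sw.prods_def)
  have bad_swap: "card (sw.bad_pairs Y X B) = card (bad_pairs X Y B)" for X Y B
  proof -
    have "sw.bad_pairs Y X B = prod.swap ` bad_pairs X Y B"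
      by (auto simp: bad_pairs_def sw.bad_pairs_def)
    then show ?thesis
      by (simp add: card_image)
  qed
  have final_swap: "sw.final Y X D \<longleftrightarrow> final X Y D" for X Y D
    by (simp add: final_def sw.final_def bad_swap max.commute mult.commute mult.left_commute)
  have adm_swap: "sw.admissible A2 A1 B X2 X1 \<longleftrightarrow> admissible A1 A2 B X1 X2" for X1 X2
    by (auto simp: admissible_def sw.admissible_def prods_swap)
  obtain \<A> where fam: "container_family A1 A2 B \<A>" and card: "real (card \<A>) \<le> c"
    using assms(2) by (auto simp: containable_def)
  show ?thesis
  proof (rule sw.containableI)
    let ?\<A> = "(\<lambda>(C1, C2, D). (C2, C1, D)) ` \<A>"
    have fin: "finite \<A>"
      using fam unfolding container_family_def by (elim conjE)
    have sub: "\<A> \<subseteq> Pow A1 \<times> Pow A2 \<times> UNIV"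
      using fam unfolding container_family_def by (elim conjE)
    show "finite ?\<A>" "?\<A> \<subseteq> Pow A2 \<times> Pow A1 \<times> UNIV"
      using fin sub by auto
    show "real (card ?\<A>) \<le> c"
      using card card_image_le[OF fin] by (meson of_nat_le_iff order_trans)
    fix X2 X1 assume "sw.admissible A2 A1 B X2 X1"
    then have "\<exists>(C1, C2, D) \<in> \<A>. X1 \<subseteq> C1 \<and> X2 \<subseteq> C2 \<and> D \<subseteq> prods X1 X2"
      using fam unfolding adm_swap container_family_def by metis
    then obtain C1 C2 D where "(C1, C2, D) \<in> \<A>" "X1 \<subseteq> C1" "X2 \<subseteq> C2" "D \<subseteq> prods X1 X2"
      by blast
    then show "\<exists>(C1, C2, D) \<in> ?\<A>. X2 \<subseteq> C1 \<and> X1 \<subseteq> C2 \<and> D \<subseteq> sw.prods X2 X1"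
      by (intro bexI[of _ "(C2, C1, D)"] rev_image_eqI[of "(C1, C2, D)"]) (auto simp: prods_swap)
  next
    fix C2 C1 D assume "(C2, C1, D) \<in> (\<lambda>(C1, C2, D). (C2, C1, D)) ` \<A>"
    then have "(C1, C2, D) \<in> \<A>"
      by auto
    then show "sw.final C2 C1 D"
      using container_family_final[OF fam] final_swap by blast
  qed
qed

section \<open>Iteration of the rounds\<close>

context container_setup
begin

lemma containable_mono: "containable A1 A2 B c \<Longrightarrow> c \<le> d \<Longrightarrow> containable A1 A2 B d"
  unfolding containable_def by (meson order_trans)

text \<open>An admissible pair forces \<open>card B <= m\<close> and nonempty sides, so only the
  constant term of the potential remains, and that is the cost in
  \<open>containable_small\<close>.\<close>

lemma potential_ge:
  assumes adm: "admissible A1 A2 B X1 X2" and fin: "finite A1" "finite A2"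
  shows "2 * real k / h + 1 + L * real m / (2 * h * real k) \<le> potential A1 A2 B"
proof -
  have "finite X1" "finite X2"
    using adm fin finite_subset by (auto simp: admissible_def)
  then have "card B \<le> card (prods X1 X2)"
    using adm by (intro card_mono finite_prods) (auto simp: admissible_def)
  then have "card B \<le> m"
    using adm by (simp add: admissible_def)
  moreover have "s1 \<le> card A1" "s2 \<le> card A2"
    using adm fin card_mono by (auto simp: admissible_def)
  then have "1 \<le> card A1" "1 \<le> card A2"
    using k_pos k_le1 k_le2 by linarith+
  then have "0 \<le> ln (real (card A1))" "0 \<le> ln (real (card A2))"
    by auto
  ultimately show ?thesis
    unfolding potential_def using h_pos L_pos by simp
qed

text \<open>The potential is real, so the induction runs over an integer bound \<open>j\<close> for
  it; each round lowers it by at least 1. At \<open>j = 0\<close> no admissible pair is left and the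
  empty family suffices.\<close>

lemma containable_potential_aux:
  assumes "A1 \<subseteq> F1" "A2 \<subseteq> F2" "finite B" "potential A1 A2 B \<le> real j"
  shows "containable A1 A2 B (exp (potential A1 A2 B))"
  using assms
proof (induction j arbitrary: A1 A2 B)
  case (0 A1 A2 B)
  have fin: "finite A1" "finite A2"
    using 0 fin1 fin2 finite_subset by blast+
  have "0 < 2 * real k / h + 1 + L * real m / (2 * h * real k)"
    using h_pos L_pos by (intro add_nonneg_pos add_pos_nonneg) auto
  then have "\<not> admissible A1 A2 B X1 X2" for X1 X2
    using potential_ge[OF _ fin, of B X1 X2] 0(4) by auto
  then show ?case
    by (intro containableI[of "{}"]) auto
next
  case (Suc j A1 A2 B)
  have fin: "finite A1" "finite A2"
    using Suc.prems fin1 fin2 finite_subset by blast+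
  have IH: "containable A1' A2' B' (exp (potential A1' A2' B'))"
    if "A1' \<subseteq> A1" "A2' \<subseteq> A2" "finite B'" "potential A1' A2' B' \<le> potential A1 A2 B - 1" for A1' A2' B'
    using that Suc.prems by (intro Suc.IH) auto
  interpret sw: container_setup "\<lambda>y x. f x y" F2 F1 s2 s1 m k L h
    by (rule swapped)
  have sw_potential: "sw.potential Y X D = potential X Y D" for X Y D
    by (simp add: potential_def sw.potential_def add.commute)
  have bad_swap: "card (sw.bad_pairs A2 A1 B) = card (bad_pairs A1 A2 B)"
    using fin by (simp add: sw.card_bad_pairs_by_left card_bad_pairs_by_right)
  show ?case
  proof (cases "\<exists>X1 X2. admissible A1 A2 B X1 X2")
    case False
    then show ?thesis
      by (intro containableI[of "{}"]) auto
  next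
    case True
    then have pot: "2 * real k / h + 1 + L * real m / (2 * h * real k) \<le> potential A1 A2 B"
      using potential_ge fin by blast
    moreover have "0 \<le> 2 * real k / h + 1 + L * real m / (2 * h * real k)"
      using h_pos L_pos by simp
    ultimately have pot_nonneg: "0 \<le> potential A1 A2 B"
      by linarith
    consider "final A1 A2 B" | "\<not> final A1 A2 B" "card A1 \<le> card A2" | "\<not> final A1 A2 B" "card A2 \<le> card A1"
      by linarith
    then show ?thesis
    proof cases
      case 1
      then show ?thesis
        using pot_nonneg by (intro containableI[of "{(A1, A2, B)}"]) (auto simp: admissible_def)
    next
      case 2
      show ?thesis
      proof (cases "real (card A1) \<le> 2 * real k / h")
        case True
        then show ?thesis
          using containable_small[of A1 A2 B] Suc.prems pot by (auto intro: containable_mono)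
      next
        case False
        show ?thesis
        proof (rule containable_step[OF Suc.prems(1-3) _ _ _ IH])
          show "2 * real k / h < real (card A1)"
            using False by simp
          show "real m / L < real (card A2)"
            "2 * h * real (card A1) * real (card A2) < real (card (bad_pairs A1 A2 B))"
            using 2 by (auto simp: final_def)
        qed
      qed
    next
      case 3
      have "sw.containable A2 A1 B (exp (sw.potential A2 A1 B))"
      proof (cases "real (card A2) \<le> 2 * real k / h")
        case True
        then show ?thesis
          using sw.containable_small[of A2 A1 B] Suc.prems pot
          by (auto simp: sw_potential intro: sw.containable_mono)
      next
        case False
        have sw_IH: "sw.containable Y X D (exp (sw.potential Y X D))"
          if "Y \<subseteq> A2" "X \<subseteq> A1" "finite D" "sw.potential Y X D \<le> sw.potential A2 A1 B - 1" for X Y D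
          using containable_swap[OF container_setup_axioms IH[of X Y D]] that
          by (simp add: sw_potential)
        show ?thesis
        proof (rule sw.containable_step[OF Suc.prems(2,1,3) _ _ _ sw_IH])
          show "2 * real k / h < real (card A2)"
            using False by simp
          show "real m / L < real (card A1)"
            "2 * h * real (card A2) * real (card A1) < real (card (sw.bad_pairs A2 A1 B))"
            using 3 by (auto simp: final_def bad_swap mult.commute mult.left_commute)
        qed
      qed
      then show ?thesis
        using containable_swap[OF swapped] by (simp add: sw_potential)
    qed
  qed
qed

lemma containable_potential:
  assumes "A1 \<subseteq> F1" "A2 \<subseteq> F2" "finite B"
  shows "containable A1 A2 B (exp (potential A1 A2 B))"
  using containable_potential_aux[OF assms] real_arch_simple by blast

end

section \<open>Numerical bound for the initial potential\<close>

lemma container_exponent_le: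
  fixes k m :: nat and L h :: real
  assumes L: "1 / 2 \<le> L" and Lm: "L \<le> real m" and h: "0 < h" "h \<le> 1 / 2"
    and k: "sqrt (real m / L) \<le> real k" "real k \<le> 2 * sqrt (real m / L)"
  shows "20 * real k * L / h * (L + L) + 160 * L / (h * real k) * real m +
      (2 * real k / h + 1 + L * real m / (2 * h * real k))
    \<le> 2 ^ 20 * (1 / (2 * h)) * sqrt (real m) * L powr (3 / 2)"
proof -
  define q where "q = sqrt (real m / L)"
  have L0: "0 < L"
    using L by linarith
  have q1: "1 \<le> q"
    using Lm L0 by (simp add: q_def)
  have m: "real m = q ^ 2 * L"
    using L0 by (simp add: q_def)
  \<comment> \<open>\<open>M\<close> equals sqrt(m) L^(3/2). Every term on the left is at most a
    constant times \<open>M / h\<close>; the constants 80, 160, 16, 2, 1 add up to far less than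
    2^19. The terms lacking powers of \<open>L\<close> are absorbed through
    \<open>L >= 1 / 2\<close>.\<close>
  define M where "M = q * L ^ 2"
  have kq: "q \<le> real k" "real k \<le> 2 * q"
    using k by (auto simp: q_def)
  have k0: "0 < real k"
    using kq q1 by linarith
  have "sqrt (real m) * L powr (3 / 2) = M"
  proof -
    have "sqrt (real m) = q * sqrt L"
      using q1 by (simp add: m real_sqrt_mult)
    moreover have "sqrt L * L powr (3 / 2) = L powr 2"
      using L0 by (simp add: powr_half_sqrt[symmetric] flip: powr_add)
    moreover have "L powr 2 = L ^ 2"
      using L0 powr_realpow[of L 2] by simp
    ultimately show ?thesis
      by (simp add: M_def)
  qed
  then have rhs: "2 ^ 20 * (1 / (2 * h)) * sqrt (real m) * L powr (3 / 2) = 524288 * (M / h)"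
    by (simp add: field_simps)
  have "(1 / 2) ^ 2 \<le> L ^ 2"
    using L by (intro power_mono) auto
  then have L2: "1 / 4 \<le> L ^ 2"
    by (simp add: power2_eq_square)
  have "q * (1 / 4) \<le> q * L ^ 2"
    using L2 q1 by (intro mult_left_mono) auto
  then have qM: "q \<le> 4 * M"
    by (simp add: M_def)
  have mk: "L * real m / real k \<le> M"
  proof -
    have "L * real m = M * q"
      by (simp add: m M_def power2_eq_square)
    also have "\<dots> \<le> M * real k"
      using kq qM q1 by (intro mult_left_mono) auto
    finally show ?thesis
      using k0 by (simp add: field_simps)
  qed
  have t1: "20 * real k * L / h * (L + L) \<le> 80 * (M / h)"
  proof -
    have "real k * L ^ 2 \<le> 2 * q * L ^ 2"
      using kq by (intro mult_right_mono) auto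
    then have "40 * (real k * L ^ 2) / h \<le> 80 * M / h"
      using h by (intro divide_right_mono) (auto simp: M_def)
    then show ?thesis
      by (simp add: power2_eq_square field_simps)
  qed
  have t2: "160 * L / (h * real k) * real m \<le> 160 * (M / h)"
  proof -
    have "160 * L / (h * real k) * real m = 160 * ((L * real m / real k) / h)"
      by (simp add: field_simps)
    also have "\<dots> \<le> 160 * (M / h)"
      using mk h by (intro mult_left_mono divide_right_mono) auto
    finally show ?thesis .
  qed
  have t3: "2 * real k / h \<le> 16 * (M / h)"
  proof -
    have "2 * real k / h \<le> 16 * M / h"
      using kq qM h by (intro divide_right_mono) auto
    then show ?thesis
      by simp
  qed
  have t4: "1 \<le> 2 * (M / h)"
  proof -
    have "h \<le> 2 * M"
      using h q1 qM by linarith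
    then show ?thesis
      using h by (simp add: field_simps)
  qed
  have t5: "L * real m / (2 * h * real k) \<le> M / h"
  proof -
    have "L * real m / (2 * h * real k) = (L * real m / real k) / h / 2"
      by (simp add: field_simps)
    also have "\<dots> \<le> M / h / 2"
      using mk h by (intro divide_right_mono) auto
    also have "\<dots> \<le> M / h"
      using h q1 qM by (simp add: field_simps)
    finally show ?thesis .
  qed
  have "0 \<le> M / h"
    using h q1 qM by simp
  then show ?thesis
    unfolding rhs using t1 t2 t3 t4 t5 by linarith
qed

section \<open>The container theorem for groups\<close>

theorem theorem2p2:
  fixes G :: "('a, 'b) monoid_scheme" (structure)
    and \<epsilon> :: real
    and n m s\<^sub>1 s\<^sub>2 :: int
    and F\<^sub>1 F\<^sub>2 F :: "'a set"
  assumes "group G"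
    and "\<epsilon> > 0"
    and "s\<^sub>1 \<le> s\<^sub>2"
    and "ln (real_of_int n) \<le> real_of_int s\<^sub>2"
    and "s\<^sub>2 \<le> m"
    and "real_of_int m \<le> (real_of_int s\<^sub>1)^2 * ln (real_of_int n)"
    and "F\<^sub>1 \<subseteq> carrier G" and "F\<^sub>2 \<subseteq> carrier G"
    and "finite F\<^sub>1" and "finite F\<^sub>2"
    and "int (card F\<^sub>1) = n" and "int (card F\<^sub>2) = n"
    and "F = F\<^sub>1 <#> F\<^sub>2"
  shows "\<exists>\<A> \<subseteq> Pow F\<^sub>1 \<times> Pow F\<^sub>2 \<times> Pow F.
    real (card \<A>) \<le> exp (2 ^ 20 * (1 / \<epsilon>^2) * sqrt (real_of_int m) * ln (real_of_int n) powr (3/2)) \<and>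
    (\<forall>X\<^sub>1 X\<^sub>2. X\<^sub>1 \<subseteq> F\<^sub>1 \<and> X\<^sub>2 \<subseteq> F\<^sub>2 \<and> int (card X\<^sub>1) = s\<^sub>1 \<and> int (card X\<^sub>2) = s\<^sub>2 \<and>
        int (card (X\<^sub>1 <#> X\<^sub>2)) \<le> m \<longrightarrow>
        (\<exists>(A\<^sub>1, A\<^sub>2, B) \<in> \<A>. X\<^sub>1 \<subseteq> A\<^sub>1 \<and> X\<^sub>2 \<subseteq> A\<^sub>2 \<and> B \<subseteq> X\<^sub>1 <#> X\<^sub>2)) \<and>
    (\<forall>(A\<^sub>1, A\<^sub>2, B) \<in> \<A>.
        real (max (card A\<^sub>1) (card A\<^sub>2)) \<le> real_of_int m / ln (real_of_int n) \<or>
        real (card {(a\<^sub>1, a\<^sub>2) \<in> A\<^sub>1 \<times> A\<^sub>2. a\<^sub>1 \<otimes> a\<^sub>2 \<notin> B})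
          \<le> \<epsilon>^2 * real (card A\<^sub>1) * real (card A\<^sub>2))"
proof -
  interpret group G
    by (rule assms(1))
  let ?E = "exp (2 ^ 20 * (1 / \<epsilon>^2) * sqrt (real_of_int m) * ln (real_of_int n) powr (3/2))"
  have n_nonneg: "0 \<le> n"
    using assms(11) by linarith
  then have ln_nonneg: "0 \<le> ln (real_of_int n)"
    by (cases "n = 0") auto
  then have m_nonneg: "0 \<le> m"
    using assms(4,5) by linarith
  have E_ge: "1 \<le> ?E"
    using m_nonneg by simp
  \<comment> \<open>For \<open>1 <= \<epsilon>^2\<close> the single triple
    \<open>(F\<^sub>1, F\<^sub>2, {})\<close> works, and for negative \<open>s\<^sub>1\<close> there
    is nothing to cover. The last case supplies \<open>h <= 1 / 2\<close> and
    \<open>L >= 1 / 2\<close>.\<close>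
  consider "1 \<le> \<epsilon>^2" | "n \<le> 1" | "s\<^sub>1 < 0" | "\<epsilon>^2 < 1" "2 \<le> n" "0 \<le> s\<^sub>1"
    by linarith
  then show ?thesis
  proof cases
    case 1
    have "card {(a\<^sub>1, a\<^sub>2) \<in> F\<^sub>1 \<times> F\<^sub>2. a\<^sub>1 \<otimes> a\<^sub>2 \<notin> {}} = card F\<^sub>1 * card F\<^sub>2"
      by (simp add: card_cartesian_product)
    moreover have "1 * (real (card F\<^sub>1) * real (card F\<^sub>2)) \<le> \<epsilon>^2 * (real (card F\<^sub>1) * real (card F\<^sub>2))"
      using 1 by (intro mult_right_mono) auto
    ultimately show ?thesis
      using E_ge by (intro exI[of _ "{(F\<^sub>1, F\<^sub>2, {})}"]) (simp add: mult.assoc)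
  next
    case 2
    \<comment> \<open>\<open>ln 0 = 0\<close> in HOL covers \<open>n = 0\<close>. Now
      \<open>m\<close> is 0, only empty sets need covering, and the quotient in (2) is
      \<open>0 / 0 = 0\<close>.\<close>
    then have "ln (real_of_int n) = 0"
      using n_nonneg by (cases "n = 0") auto
    then have "m = 0" "s\<^sub>2 \<le> 0" "s\<^sub>1 \<le> 0"
      using assms(3,5,6) m_nonneg by auto
    moreover have "X = {}" if "X \<subseteq> F\<^sub>1 \<or> X \<subseteq> F\<^sub>2" "int (card X) \<le> 0" for X
      using that assms(9,10) finite_subset by fastforce
    ultimately show ?thesis
      using E_ge by (intro exI[of _ "{({}, {}, {})}"]) auto
  next
    case 3
    then show ?thesis
      by (intro exI[of _ "{}"]) auto
  next
    case 4
    define L where "L = ln (real_of_int n)"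
    define q where "q = sqrt (real_of_int m / L)"
    define k where "k = nat \<lceil>q\<rceil>"
    have "ln 2 \<le> L"
      using 4 by (simp add: L_def)
    then have L: "1 / 2 \<le> L"
      using half_le_ln2 by linarith
    \<comment> \<open>This makes \<open>q >= 1\<close>, so that rounding \<open>q\<close> up to
      \<open>k\<close> at most doubles it.\<close>
    have Lm: "L \<le> real_of_int m"
      using assms(4,5) by (simp add: L_def)
    have q1: "1 \<le> q"
      using L Lm by (simp add: q_def)
    have k: "q \<le> real k" "real k \<le> 2 * q" "0 < k"
      using q1 unfolding k_def by linarith+
    have "real_of_int m / L \<le> (real_of_int s\<^sub>1)^2"
      using assms(6) L by (simp add: L_def field_simps)
    then have "q \<le> real_of_int s\<^sub>1"
      using 4 unfolding q_def by (intro real_le_lsqrt) auto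
    then have "\<lceil>q\<rceil> \<le> s\<^sub>1"
      by (simp add: ceiling_le_iff)
    then have k_le: "k \<le> nat s\<^sub>1" "k \<le> nat s\<^sub>2"
      unfolding k_def using assms(3) by (intro nat_mono; linarith)+
    have cards: "real (card F\<^sub>1) = real_of_int n" "real (card F\<^sub>2) = real_of_int n"
      using assms(11,12) by linarith+
    have m: "real (nat m) = real_of_int m"
      using m_nonneg by simp
    have "real k ^ 2 \<le> (2 * q) ^ 2"
      using k by (intro power_mono) auto
    also have "\<dots> = 4 * real_of_int m / L"
      using m_nonneg L by (simp add: q_def power_mult_distrib)
    finally have k_upper: "real k ^ 2 * L \<le> 4 * real (nat m)"
      using L m by (simp add: field_simps)
    interpret cs: container_setup "\<lambda>x y. x \<otimes> y" F\<^sub>1 F\<^sub>2 "nat s\<^sub>1" "nat s\<^sub>2" "nat m" k L "\<epsilon>^2 / 2"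
    proof
      show "inj_on (\<lambda>x. x \<otimes> y) F\<^sub>1" if "y \<in> F\<^sub>2" for y
        using that assms(7,8) by (auto simp: inj_on_def subset_iff)
      show "inj_on ((\<otimes>) x) F\<^sub>2" if "x \<in> F\<^sub>1" for x
        using that assms(7,8) by (auto simp: inj_on_def subset_iff)
      show "real (card F\<^sub>1) \<le> exp L" "real (card F\<^sub>2) \<le> exp L"
        using 4 by (auto simp: cards L_def)
    qed (use assms(2,9,10) L k k_le k_upper in auto)
    have prods: "cs.prods X Y = X <#> Y" for X Y
      by (auto simp: cs.prods_def set_mult_def)
    have "cs.potential F\<^sub>1 F\<^sub>2 {} \<le>
        2 ^ 20 * (1 / (2 * (\<epsilon>^2 / 2))) * sqrt (real (nat m)) * L powr (3 / 2)"
      using container_exponent_le[of L "nat m" "\<epsilon>^2 / 2" k] 4 assms(2) L Lm k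
      by (simp add: cs.potential_def cards m q_def flip: L_def)
    then have "exp (cs.potential F\<^sub>1 F\<^sub>2 {}) \<le> ?E"
      by (simp add: m L_def)
    then have "cs.containable F\<^sub>1 F\<^sub>2 {} ?E"
      using cs.containable_potential[of F\<^sub>1 F\<^sub>2 "{}"] cs.containable_mono by blast
    then obtain \<A> where fam: "cs.container_family F\<^sub>1 F\<^sub>2 {} \<A>" and card: "real (card \<A>) \<le> ?E"
      by (auto simp: cs.containable_def)
    have fin: "finite \<A>"
      using fam unfolding cs.container_family_def by (elim conjE)
    have sub: "\<A> \<subseteq> Pow F\<^sub>1 \<times> Pow F\<^sub>2 \<times> UNIV"
      using fam unfolding cs.container_family_def by (elim conjE)
    \<comment> \<open>Dropping triples with \<open>B\<close> outside \<open>F\<close> loses no pair: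
      a triple covering \<open>X\<^sub>1\<close>, \<open>X\<^sub>2\<close> has \<open>B\<close>
      inside their product set, which lies in \<open>F\<close>.\<close>
    define \<B> where "\<B> = \<A> \<inter> UNIV \<times> UNIV \<times> Pow F"
    have final: "real (max (card A\<^sub>1) (card A\<^sub>2)) \<le> real_of_int m / ln (real_of_int n) \<or>
        real (card {(a\<^sub>1, a\<^sub>2) \<in> A\<^sub>1 \<times> A\<^sub>2. a\<^sub>1 \<otimes> a\<^sub>2 \<notin> B}) \<le> \<epsilon>^2 * real (card A\<^sub>1) * real (card A\<^sub>2)"
      if "(A\<^sub>1, A\<^sub>2, B) \<in> \<B>" for A\<^sub>1 A\<^sub>2 B
    proof -
      have "cs.final A\<^sub>1 A\<^sub>2 B"
        using that cs.container_family_final[OF fam] by (auto simp: \<B>_def)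
      then show ?thesis
        unfolding cs.final_def cs.bad_pairs_def m by (simp add: L_def)
    qed
    have "card \<B> \<le> card \<A>"
      using fin by (auto simp: \<B>_def intro: card_mono)
    then have "real (card \<B>) \<le> ?E"
      using card by linarith
    moreover have "\<B> \<subseteq> Pow F\<^sub>1 \<times> Pow F\<^sub>2 \<times> Pow F"
      using sub by (auto simp: \<B>_def)
    moreover have "\<exists>(A\<^sub>1, A\<^sub>2, B) \<in> \<B>. X\<^sub>1 \<subseteq> A\<^sub>1 \<and> X\<^sub>2 \<subseteq> A\<^sub>2 \<and> B \<subseteq> X\<^sub>1 <#> X\<^sub>2"
      if X: "X\<^sub>1 \<subseteq> F\<^sub>1 \<and> X\<^sub>2 \<subseteq> F\<^sub>2 \<and> int (card X\<^sub>1) = s\<^sub>1 \<and> int (card X\<^sub>2) = s\<^sub>2 \<and>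
        int (card (X\<^sub>1 <#> X\<^sub>2)) \<le> m" for X\<^sub>1 X\<^sub>2
    proof -
      have "cs.admissible F\<^sub>1 F\<^sub>2 {} X\<^sub>1 X\<^sub>2"
        using X by (auto simp: cs.admissible_def prods)
      then have "\<exists>(A\<^sub>1, A\<^sub>2, B) \<in> \<A>. X\<^sub>1 \<subseteq> A\<^sub>1 \<and> X\<^sub>2 \<subseteq> A\<^sub>2 \<and> B \<subseteq> X\<^sub>1 <#> X\<^sub>2"
        using fam unfolding cs.container_family_def prods by metis
      moreover have "X\<^sub>1 <#> X\<^sub>2 \<subseteq> F"
        using X by (auto simp: assms(13) set_mult_def)
      ultimately obtain A\<^sub>1 A\<^sub>2 B where "(A\<^sub>1, A\<^sub>2, B) \<in> \<A>" "B \<subseteq> F"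
          "X\<^sub>1 \<subseteq> A\<^sub>1" "X\<^sub>2 \<subseteq> A\<^sub>2" "B \<subseteq> X\<^sub>1 <#> X\<^sub>2"
        by blast
      then show ?thesis
        by (intro bexI[of _ "(A\<^sub>1, A\<^sub>2, B)"]) (auto simp: \<B>_def)
    qed
    moreover have "\<forall>(A\<^sub>1, A\<^sub>2, B) \<in> \<B>.
        real (max (card A\<^sub>1) (card A\<^sub>2)) \<le> real_of_int m / ln (real_of_int n) \<or>
        real (card {(a\<^sub>1, a\<^sub>2) \<in> A\<^sub>1 \<times> A\<^sub>2. a\<^sub>1 \<otimes> a\<^sub>2 \<notin> B}) \<le> \<epsilon>^2 * real (card A\<^sub>1) * real (card A\<^sub>2)"
      by (rule ballI) (use final in \<open>simp only: split_paired_all prod.case\<close>)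
    ultimately show ?thesis
      by (intro exI[of _ \<B>] conjI allI impI)
  qed
qed

end
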